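(* Let $k\ge 1$ and $c\ge 1$ be integers and let $G=K_{c,\dots,c}$ be the complete $k$-partite graph in which each of the $k$ colour classes has order $c$. Then $$\mathrm{tw}(L(G))=\mathrm{pw}(L(G))=\begin{cases}\frac{c^2k^2}{4}-\frac{c^2k}{4}+\frac{ck}{2}-\frac c2+\frac k4-\frac54 & \text{if } k \text{ is odd and } c \text{ is odd},\\[2pt] \frac{c^2k^2}{4}-\frac{c^2k}{4}+\frac{ck}{2}-\frac c2-1 & \text{if } c \text{ is even},\\[2pt] \frac{c^2k^2}{4}-\frac{c^2k}{4}+\frac{ck}{2}-\frac c2+\frac k4-\frac32 & \text{if } k \text{ is even and } c \text{ is odd},\end{cases}$$ where $L(G)$ is the line graph of $G$, $\mathrm{tw}$ is treewidth and $\mathrm{pw}$ is pathwidth.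
   Context: All graphs are finite and simple. The complete multipartite graph $K_{n_1,\dots,n_k}$ has $k$ colour classes of orders $n_1,\dots,n_k$, with an edge between two vertices exactly when they lie in different colour classes. The line graph $L(G)$ of $G$ has vertex set $E(G)$, two vertices of $L(G)$ being adjacent when the corresponding (distinct) edges of $G$ share an endpoint. A tree decomposition of a graph $G$ is a pair $(T,\{A_x\subseteq V(G):x\in V(T)\})$ where $T$ is a tree (with at least one node), such that for every $v\in V(G)$ the nodes $x$ with $v\in A_x$ induce a non-empty connected subtree of $T$, and for every edge $vw\in E(G)$ some bag $A_x$ contains both $v$ and $w$. Its width is the maximum size of a bag minus $1$. The treewidth $\mathrm{tw}(G)$ is the minimum width of a tree decomposition of $G$; the pathwidth $\mathrm{pw}(G)$ is the minimum width of a tree decomposition of $G$ whose underlying tree is a path. (With this definition the graph with no vertices has treewidth and pathwidth $-1$.) *)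

theory Defs
  imports Complex_Main
begin

type_synonym 'a graph = "'a set \<times> 'a set set"

abbreviation verts :: "'a graph \<Rightarrow> 'a set" where "verts \<equiv> fst"

abbreviation edges :: "'a graph \<Rightarrow> 'a set set" where "edges \<equiv> snd"

definition simple_graph :: "'a graph \<Rightarrow> bool" where
  "simple_graph G \<longleftrightarrow> finite (verts G) \<and> (\<forall>e\<in>edges G. e \<subseteq> verts G \<and> card e = 2)"

definition complete_multipartite :: "nat list \<Rightarrow> (nat \<times> nat) graph" where
  "complete_multipartite ns =
    (let V = {(i, j). i < length ns \<and> j < ns ! i}
     in (V, {{u, v} | u v. u \<in> V \<and> v \<in> V \<and> fst u \<noteq> fst v}))"

definition line_graph :: "'a graph \<Rightarrow> 'a set graph" where
  "line_graph G =
    (edges G, {{e, f} | e f. e \<in> edges G \<and> f \<in> edges G \<and> e \<noteq> f \<and> e \<inter> f \<noteq> {}})"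

definition induced_subgraph :: "'a graph \<Rightarrow> 'a set \<Rightarrow> 'a graph" where
  "induced_subgraph G S = (verts G \<inter> S, {e \<in> edges G. e \<subseteq> S})"

definition connected_graph :: "'a graph \<Rightarrow> bool" where
  "connected_graph G \<longleftrightarrow> verts G \<noteq> {} \<and>
    (\<forall>u\<in>verts G. \<forall>v\<in>verts G. (u, v) \<in> {(x, y). {x, y} \<in> edges G}\<^sup>*)"

definition is_cycle :: "'a graph \<Rightarrow> 'a list \<Rightarrow> bool" where
  "is_cycle G xs \<longleftrightarrow> length xs \<ge> 3 \<and> distinct xs \<and> set xs \<subseteq> verts G \<and>
    (\<forall>i. Suc i < length xs \<longrightarrow> {xs ! i, xs ! Suc i} \<in> edges G) \<and>
    {last xs, hd xs} \<in> edges G"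

definition is_tree :: "'a graph \<Rightarrow> bool" where
  "is_tree T \<longleftrightarrow> simple_graph T \<and> connected_graph T \<and> (\<nexists>xs. is_cycle T xs)"

definition is_path_graph :: "'a graph \<Rightarrow> bool" where
  "is_path_graph T \<longleftrightarrow> (\<exists>xs. xs \<noteq> [] \<and> distinct xs \<and> verts T = set xs \<and>
    edges T = {{xs ! i, xs ! Suc i} | i. Suc i < length xs})"

definition tree_decomposition :: "'a graph \<Rightarrow> 'n graph \<Rightarrow> ('n \<Rightarrow> 'a set) \<Rightarrow> bool" where
  "tree_decomposition G T A \<longleftrightarrow>
    is_tree T \<and>
    (\<forall>x\<in>verts T. A x \<subseteq> verts G) \<and>
    (\<forall>v\<in>verts G. connected_graph (induced_subgraph T {x \<in> verts T. v \<in> A x})) \<and>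
    (\<forall>v w. {v, w} \<in> edges G \<longrightarrow> (\<exists>x\<in>verts T. v \<in> A x \<and> w \<in> A x))"

text \<open>Integer-valued, so that the empty graph gets width \<open>-1\<close>.\<close>

definition width :: "'n graph \<Rightarrow> ('n \<Rightarrow> 'a set) \<Rightarrow> int" where
  "width T A = int (Max ((\<lambda>x. card (A x)) ` verts T)) - 1"

text \<open>
  Decomposition trees are finite, so taking their nodes to be natural numbers loses no generality.
  Widths are bounded below by \<open>-1\<close> and every finite graph has a decomposition with a single node,
  so the minima below exist.
\<close>

definition treewidth :: "'a graph \<Rightarrow> int" where
  "treewidth G = (LEAST w. \<exists>(T :: nat graph) A. tree_decomposition G T A \<and> width T A = w)"

definition pathwidth :: "'a graph \<Rightarrow> int" where
  "pathwidth G = (LEAST w. \<exists>(T :: nat graph) A.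
     tree_decomposition G T A \<and> is_path_graph T \<and> width T A = w)"

lemma finite_complete_multipartite: "finite (verts (complete_multipartite ns))"
proof -
  have "{(i, j). i < length ns \<and> j < ns ! i} = Sigma {..<length ns} (\<lambda>i. {..<ns ! i})" by auto
  then show ?thesis by (simp add: complete_multipartite_def Let_def)
qed

lemma simple_graph_complete_multipartite: "simple_graph (complete_multipartite ns)"
  using finite_complete_multipartite[of ns]
  by (auto simp: simple_graph_def complete_multipartite_def Let_def card_2_iff)

lemma simple_graph_line_graph:
  assumes "simple_graph G" shows "simple_graph (line_graph G)"
proof -
  have "edges G \<subseteq> Pow (verts G)" using assms by (auto simp: simple_graph_def)
  then have "finite (edges G)" using assms by (meson finite_Pow_iff finite_subset simple_graph_def)
  then show ?thesis by (auto simp: simple_graph_def line_graph_def card_2_iff)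
qed

lemma trivial_tree_decomposition:
  assumes "simple_graph G"
  shows "tree_decomposition G ({0 :: nat}, {}) (\<lambda>_. verts G)" "is_path_graph ({0 :: nat}, {})"
proof -
  have "\<not> is_cycle ({0 :: nat}, {}) xs" for xs by (auto simp: is_cycle_def)
  moreover have "v \<in> verts G \<and> w \<in> verts G" if "{v, w} \<in> edges G" for v w
    using assms that by (auto simp: simple_graph_def)
  ultimately show "tree_decomposition G ({0 :: nat}, {}) (\<lambda>_. verts G)"
    by (auto simp: tree_decomposition_def is_tree_def simple_graph_def connected_graph_def
        induced_subgraph_def)
  show "is_path_graph ({0 :: nat}, {})"
    by (auto simp: is_path_graph_def intro!: exI[of _ "[0]"])
qed

lemma int_Least_attained:
  fixes P :: "int \<Rightarrow> bool"
  assumes "P a" and low: "\<And>w. P w \<Longrightarrow> w \<ge> -1"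
  shows "P (LEAST w. P w)" and "P b \<Longrightarrow> (LEAST w. P w) \<le> b"
proof -
  define m where "m = (LEAST n. P (int n - 1))"
  have ex: "P (int (nat (w + 1)) - 1)" if "P w" for w using that low[OF that] by simp
  have m: "P (int m - 1)" unfolding m_def using ex[OF assms(1)] by (rule LeastI)
  have le: "int m - 1 \<le> w" if "P w" for w
  proof -
    have "m \<le> nat (w + 1)" unfolding m_def using ex[OF that] by (rule Least_le)
    then show ?thesis using low[OF that] by linarith
  qed
  have "(LEAST w. P w) = int m - 1" using m le by (intro Least_equality)
  then show "P (LEAST w. P w)" "P b \<Longrightarrow> (LEAST w. P w) \<le> b" using m le by auto
qed

lemma treewidth_attained:
  assumes "simple_graph G"
  shows "\<exists>(T :: nat graph) A. tree_decomposition G T A \<and> width T A = treewidth G"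
proof -
  let ?P = "\<lambda>w. \<exists>(T :: nat graph) A. tree_decomposition G T A \<and> width T A = w"
  have "?P (width ({0 :: nat}, {}) (\<lambda>_. verts G))"
    using trivial_tree_decomposition[OF assms] by blast
  moreover have "w \<ge> -1" if "?P w" for w using that by (auto simp: width_def)
  ultimately show ?thesis unfolding treewidth_def by (rule int_Least_attained(1)[of ?P])
qed

lemma pathwidth_attained:
  assumes "simple_graph G"
  shows "\<exists>(T :: nat graph) A.
    tree_decomposition G T A \<and> is_path_graph T \<and> width T A = pathwidth G"
proof -
  let ?P = "\<lambda>w. \<exists>(T :: nat graph) A.
    tree_decomposition G T A \<and> is_path_graph T \<and> width T A = w"
  have "?P (width ({0 :: nat}, {}) (\<lambda>_. verts G))"
    using trivial_tree_decomposition[OF assms] by blast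
  moreover have "w \<ge> -1" if "?P w" for w using that by (auto simp: width_def)
  ultimately show ?thesis unfolding pathwidth_def by (rule int_Least_attained(1)[of ?P])
qed

end

(*
  Write n = c k and G = K_{c,...,c}.

  Lower bound. For a set X of edges of G call a component of G - X big if it has more than n/2
  vertices, or exactly n/2 vertices including a fixed vertex v0. Any two big components, even for
  different sets X, share a vertex. If every bag A_z of a tree decomposition of L(G) left a big
  component of G - A_z, the nodes whose bags meet the edges of these components would form
  pairwise intersecting subtrees; by the Helly property some node z would lie in all of them,
  although A_z avoids the component belonging to z. So some bag X leaves no big component. Then
  G - X has at least three components, each of order at most n/2, and X contains all edges of G
  between them. By convexity of the Turan numbers, the components together keep the most edges
  when their orders are floor(n/2), ceil(n/2) - 1 and 1.

  Upper bound. Order the vertices of G cyclically through the colour classes, and let the i-th bag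
  consist of the edges incident to the i-th vertex and those passing over it.
*)
theory Submission
  imports Defs
begin

section \<open>Helly property of subtrees\<close>

text \<open>Phrased for a node set inside a fixed graph, so that several subtrees of one tree can be
  compared directly. The empty set counts as connected, unlike under
  \<open>connected_graph\<close>.\<close>

definition connected_in :: "'a graph \<Rightarrow> 'a set \<Rightarrow> bool" where
  "connected_in G S \<longleftrightarrow> (\<forall>u\<in>S. \<forall>v\<in>S. (u, v) \<in> {(x, y). {x, y} \<in> edges G \<and> x \<in> S \<and> y \<in> S}\<^sup>*)"

lemma connected_graph_induced_subgraph_iff:
  assumes "S \<subseteq> verts G"
  shows "connected_graph (induced_subgraph G S) \<longleftrightarrow> S \<noteq> {} \<and> connected_in G S"
proof -
  have "verts G \<inter> S = S" using assms by blast
  moreover have "{(x, y). {x, y} \<in> edges G \<and> {x, y} \<subseteq> S} =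
      {(x, y). {x, y} \<in> edges G \<and> x \<in> S \<and> y \<in> S}" by auto
  ultimately show ?thesis
    by (simp add: connected_graph_def induced_subgraph_def connected_in_def)
qed

definition is_path_list :: "'a graph \<Rightarrow> 'a list \<Rightarrow> bool" where
  "is_path_list G xs \<longleftrightarrow> xs \<noteq> [] \<and> distinct xs \<and> set xs \<subseteq> verts G \<and>
     (\<forall>i. Suc i < length xs \<longrightarrow> {xs ! i, xs ! Suc i} \<in> edges G)"

lemma forest_has_leaf:
  assumes "simple_graph G" "verts G \<noteq> {}" and acyc: "\<nexists>xs. is_cycle G xs"
  obtains l p where "l \<in> verts G" "\<And>v. {l, v} \<in> edges G \<Longrightarrow> v = p"
proof -
  have fin: "finite (verts G)" using assms(1) by (simp add: simple_graph_def)
  obtain v where "v \<in> verts G" using assms(2) by blast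
  then have ex: "is_path_list G [v]" by (simp add: is_path_list_def)
  have bd: "length xs \<le> card (verts G)" if "is_path_list G xs" for xs
    using that fin unfolding is_path_list_def by (metis card_mono distinct_card)
  then obtain xs where xs: "is_path_list G xs"
    and mx: "\<And>ys. is_path_list G ys \<Longrightarrow> length ys \<le> length xs"
    using ex_has_greatest_nat[of "is_path_list G" "[v]" length "Suc (card (verts G))"] ex
    by (auto simp: less_Suc_eq_le)
  have ne: "xs \<noteq> []" using xs by (simp add: is_path_list_def)
  show ?thesis
  \<comment> \<open>On a path with a single vertex \<open>xs ! 1\<close> is unspecified; this is
    harmless, since such a vertex turns out to have no neighbour.\<close>
  proof (rule that[of "hd xs" "xs ! 1"])
    show "hd xs \<in> verts G" using xs by (auto simp: is_path_list_def)
    fix v assume e: "{hd xs, v} \<in> edges G"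
    have vV: "v \<in> verts G" and vne: "v \<noteq> hd xs"
      using e assms(1) by (auto simp: simple_graph_def card_2_iff doubleton_eq_iff)
    have "v \<in> set xs"
    proof (rule ccontr)
      assume "v \<notin> set xs"
      have "is_path_list G (v # xs)"
        unfolding is_path_list_def
      proof (intro conjI allI impI)
        fix i assume "Suc i < length (v # xs)"
        then show "{(v # xs) ! i, (v # xs) ! Suc i} \<in> edges G"
          using xs e ne by (cases i) (auto simp: is_path_list_def hd_conv_nth insert_commute)
      qed (use xs vV \<open>v \<notin> set xs\<close> in \<open>auto simp: is_path_list_def\<close>)
      then show False using mx[of "v # xs"] by simp
    qed
    then obtain i where i: "i < length xs" "v = xs ! i" by (auto simp: in_set_conv_nth)
    have "\<not> i \<ge> 2"
    proof
      assume "i \<ge> 2"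
      let ?ys = "take (Suc i) xs"
      have "is_cycle G ?ys"
        unfolding is_cycle_def
      proof (intro conjI allI impI)
        show "{last ?ys, hd ?ys} \<in> edges G"
          using i e ne by (simp add: last_conv_nth insert_commute)
        show "set ?ys \<subseteq> verts G"
          using xs set_take_subset[of "Suc i" xs] unfolding is_path_list_def by blast
      qed (use xs i \<open>i \<ge> 2\<close> in \<open>auto simp: is_path_list_def\<close>)
      then show False using acyc by blast
    qed
    moreover have "i \<noteq> 0" using i vne ne by (metis hd_conv_nth)
    ultimately have "i = 1" by simp
    then show "v = xs ! 1" using i by simp
  qed
qed

lemma connected_in_neighbour:
  assumes "connected_in G S" "l \<in> S" "S \<noteq> {l}" and leaf: "\<And>v. {l, v} \<in> edges G \<Longrightarrow> v = p"
  shows "p \<in> S \<and> {l, p} \<in> edges G"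
proof -
  obtain u where "u \<in> S" "u \<noteq> l" using assms by blast
  then have "(l, u) \<in> {(x, y). {x, y} \<in> edges G \<and> x \<in> S \<and> y \<in> S}\<^sup>*"
    using assms by (auto simp: connected_in_def)
  then show ?thesis using \<open>u \<noteq> l\<close> leaf by (cases rule: converse_rtranclE) auto
qed

lemma connected_in_remove_leaf:
  assumes "connected_in G S" and leaf: "\<And>v. {l, v} \<in> edges G \<Longrightarrow> v = p"
  shows "connected_in (induced_subgraph G (- {l})) (S - {l})"
  unfolding connected_in_def
proof (intro ballI)
  let ?r = "{(x, y). {x, y} \<in> edges G \<and> x \<in> S \<and> y \<in> S}"
  let ?r' = "{(x, y). {x, y} \<in> edges (induced_subgraph G (- {l})) \<and> x \<in> S - {l} \<and> y \<in> S - {l}}"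
  \<comment> \<open>Retracting the leaf onto its neighbour maps walks to walks avoiding the leaf.\<close>
  define \<phi> where "\<phi> x = (if x = l then p else x)" for x
  have step: "(\<phi> x, \<phi> y) \<in> ?r'\<^sup>*" if "(x, y) \<in> ?r" for x y
  proof (cases "x = l \<or> y = l")
    case True
    then have "\<phi> x = \<phi> y"
      using that leaf[of x] leaf[of y] by (auto simp: \<phi>_def insert_commute)
    then show ?thesis by simp
  next
    case False
    then have "(x, y) \<in> ?r'" using that by (auto simp: induced_subgraph_def)
    then show ?thesis using False by (auto simp: \<phi>_def)
  qed
  have "(\<phi> u, \<phi> v) \<in> ?r'\<^sup>*" if "(u, v) \<in> ?r\<^sup>*" for u v
    using that by induction (use step in \<open>auto intro: rtrancl_trans\<close>)
  note lift = this
  fix u v assume uv: "u \<in> S - {l}" "v \<in> S - {l}"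
  then have "(u, v) \<in> ?r\<^sup>*" using assms(1) by (auto simp: connected_in_def)
  from lift[OF this] show "(u, v) \<in> ?r'\<^sup>*" using uv by (simp add: \<phi>_def)
qed

text \<open>Induction on the number of vertices, deleting a leaf \<open>l\<close>. If
  \<open>{l}\<close> belongs to the family, every member contains \<open>l\<close>. Otherwise each
  member containing \<open>l\<close> also contains its neighbour \<open>p\<close>, so the members
  still meet pairwise after \<open>l\<close> is removed.\<close>

lemma Helly_forest:
  assumes "simple_graph G" "\<nexists>xs. is_cycle G xs" "\<S> \<noteq> {}"
    and "\<And>S. S \<in> \<S> \<Longrightarrow> S \<subseteq> verts G \<and> connected_in G S"
    and "\<And>S S'. S \<in> \<S> \<Longrightarrow> S' \<in> \<S> \<Longrightarrow> S \<inter> S' \<noteq> {}"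
  shows "\<Inter>\<S> \<noteq> {}"
  using assms
proof (induction "card (verts G)" arbitrary: G \<S> rule: less_induct)
  case less
  have sub: "S \<subseteq> verts G" and con: "connected_in G S" if "S \<in> \<S>" for S using less.prems(4) that by auto
  have ne: "verts G \<noteq> {}" using less.prems(3,5) sub by fastforce
  obtain l p where l: "l \<in> verts G" and leaf: "\<And>v. {l, v} \<in> edges G \<Longrightarrow> v = p"
    using forest_has_leaf[OF less.prems(1) ne less.prems(2)] by blast
  have loop: "{l, p} \<notin> edges G \<or> p \<noteq> l"
    using less.prems(1) by (auto simp: simple_graph_def)
  show ?case
  proof (cases "{l} \<in> \<S>")
    case True
    then show ?thesis using less.prems(5) by (metis Int_insert_left_if0 Inter_iff empty_iff inf_bot_left)
  next
    case False
    let ?G = "induced_subgraph G (- {l})" and ?\<S> = "(\<lambda>S. S - {l}) ` \<S>"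
    have p: "p \<in> S" "p \<noteq> l" if "S \<in> \<S>" "l \<in> S" for S
    proof -
      have "S \<noteq> {l}" using that False by blast
      then show "p \<in> S" "p \<noteq> l"
        using connected_in_neighbour[OF con[OF that(1)] that(2) _ leaf] loop by auto
    qed
    have "\<Inter>?\<S> \<noteq> {}"
    proof (rule less.hyps)
      have fin: "finite (verts G)" using less.prems(1) by (simp add: simple_graph_def)
      show "card (verts ?G) < card (verts G)"
        using fin l by (auto simp: induced_subgraph_def intro!: psubset_card_mono)
      show "simple_graph ?G" using less.prems(1) by (auto simp: simple_graph_def induced_subgraph_def)
      show "\<nexists>xs. is_cycle ?G xs"
        using less.prems(2) by (auto simp: is_cycle_def induced_subgraph_def)
      show "?\<S> \<noteq> {}" using less.prems(3) by simp
      show "S \<subseteq> verts ?G \<and> connected_in ?G S" if "S \<in> ?\<S>" for S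
        using that sub con connected_in_remove_leaf[OF _ leaf]
        by (auto simp: induced_subgraph_def)
      show "S \<inter> S' \<noteq> {}" if SS: "S \<in> ?\<S>" "S' \<in> ?\<S>" for S S'
      proof -
        obtain R R' where R: "R \<in> \<S>" "R' \<in> \<S>" "S = R - {l}" "S' = R' - {l}" using SS by blast
        \<comment> \<open>If the common vertex is the deleted leaf, its neighbour \<open>p\<close>
          lies in both sets and takes its place.\<close>
        then obtain x where "x \<in> R" "x \<in> R'" using less.prems(5)[of R R'] by blast
        then show ?thesis using R p[of R] p[of R'] by (cases "x = l") auto
      qed
    qed
    then show ?thesis using less.prems(3) by auto
  qed
qed

section \<open>Components after deleting edges, and a balanced bag\<close>

definition component :: "'a graph \<Rightarrow> 'a set set \<Rightarrow> 'a \<Rightarrow> 'a set" where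
  "component G X u = {v. (u, v) \<in> {(a, b). {a, b} \<in> edges G - X}\<^sup>*}"

lemma component_subset:
  assumes "simple_graph G" "u \<in> verts G"
  shows "component G X u \<subseteq> verts G"
proof
  fix v assume "v \<in> component G X u"
  then have "(u, v) \<in> {(a, b). {a, b} \<in> edges G - X}\<^sup>*" by (simp add: component_def)
  then show "v \<in> verts G"
    by induction (use assms in \<open>auto simp: simple_graph_def\<close>)
qed

lemma component_sym: "sym ({(a, b). {a, b} \<in> edges G - X}\<^sup>*)"
  by (rule sym_rtrancl) (auto simp: sym_def insert_commute)

lemma component_eq:
  assumes "v \<in> component G X u" shows "component G X v = component G X u"
  using assms component_sym[of G X] unfolding component_def
  by (auto dest: symD intro: rtrancl_trans)

text \<open>The first step of a walk from \<open>w\<close> to another vertex of the component is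
  such an edge. This passes from vertices of \<open>G\<close> to surviving edges, which are the
  vertices of the line graph.\<close>

lemma component_edge:
  assumes "component G X u \<noteq> {w}" "w \<in> component G X u"
  obtains v where "v \<in> component G X u" "{w, v} \<in> edges G - X"
proof -
  let ?r = "{(a, b). {a, b} \<in> edges G - X}"
  obtain x where x: "x \<in> component G X u" "x \<noteq> w" using assms by blast
  then have "(w, x) \<in> ?r\<^sup>*" using component_eq[OF assms(2)] by (auto simp: component_def)
  then show thesis
  proof (cases rule: converse_rtranclE)
    case (step v)
    then show thesis using that assms(2) unfolding component_def
      by (auto intro: rtrancl_into_rtrancl)
  qed (use x in simp)
qed

text \<open>The last conclusion breaks the tie at exactly half of the vertices: without it two
  components of order n/2 each would be possible, and a third component could not be forced later.
  The assumption of at least three vertices ensures that a big component contains an edge.\<close>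

lemma tree_decomposition_line_graph_balanced:
  assumes G: "simple_graph G" and v0: "v0 \<in> verts G" and n: "card (verts G) \<ge> 3"
    and td: "tree_decomposition (line_graph G) T A"
  obtains z where "z \<in> verts T" "\<And>u. u \<in> verts G \<Longrightarrow> 2 * card (component G (A z) u) \<le> card (verts G)"
    "2 * card (component G (A z) v0) \<noteq> card (verts G)"
proof -
  let ?n = "card (verts G)"
  define nodes where "nodes D = {x \<in> verts T. A x \<inter> D \<noteq> {}}" for D
  have T: "simple_graph T" "\<nexists>xs. is_cycle T xs" "verts T \<noteq> {}"
    using td by (auto simp: tree_decomposition_def is_tree_def connected_graph_def)
  have edge_con: "connected_in T (nodes {e})" "nodes {e} \<noteq> {}" if "e \<in> edges G" for e
  proof -
    have "nodes {e} = {x \<in> verts T. e \<in> A x}" by (auto simp: nodes_def)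
    moreover have "connected_graph (induced_subgraph T {x \<in> verts T. e \<in> A x})"
      using td that by (simp add: tree_decomposition_def line_graph_def)
    ultimately show "connected_in T (nodes {e})" "nodes {e} \<noteq> {}"
      using connected_graph_induced_subgraph_iff[of "nodes {e}" T] by (auto simp: nodes_def)
  qed
  \<comment> \<open>Edges with a common endpoint are equal or adjacent in the line graph, so their
    subtrees share a node.\<close>
  have meet: "nodes {e} \<inter> nodes {f} \<noteq> {}" if "e \<in> edges G" "f \<in> edges G" "e \<inter> f \<noteq> {}" for e f
  proof (cases "e = f")
    case False
    then have "{e, f} \<in> edges (line_graph G)" using that by (auto simp: line_graph_def)
    then obtain x where "x \<in> verts T" "e \<in> A x" "f \<in> A x"
      using td unfolding tree_decomposition_def by blast
    then show ?thesis by (auto simp: nodes_def)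
  qed (use edge_con that in auto)

  \<comment> \<open>The second alternative makes any two big components meet, even for different
    bags: either their orders add up to more than \<open>?n\<close>, or both contain
    \<open>v0\<close>.\<close>
  define big where "big z u \<longleftrightarrow> u \<in> verts G \<and> (2 * card (component G (A z) u) > ?n \<or>
      2 * card (component G (A z) u) = ?n \<and> v0 \<in> component G (A z) u)" for z u
  define D where "D z u = {e \<in> edges G - A z. e \<subseteq> component G (A z) u}" for z u
  have incident: "\<exists>e\<in>D z u. w \<in> e" if "big z u" "w \<in> component G (A z) u" for z u w
  proof -
    \<comment> \<open>Twice the order of a big component is at least \<open>?n\<close>, hence at
      least 3.\<close>
    have "card (component G (A z) u) \<noteq> 1" using that n by (auto simp: big_def)
    then have "component G (A z) u \<noteq> {w}" by auto
    from component_edge[OF this that(2)] obtain v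
      where "v \<in> component G (A z) u" "{w, v} \<in> edges G - A z" by blast
    then show ?thesis using that(2) by (intro bexI[of _ "{w, v}"]) (auto simp: D_def)
  qed
  have refl: "u \<in> component G (A z) u" for z u by (simp add: component_def)
  have D_con: "connected_in T (nodes (D z u))" if "big z u" for z u
  proof -
    let ?N = "nodes (D z u)"
    let ?r = "{(x, y). {x, y} \<in> edges T \<and> x \<in> ?N \<and> y \<in> ?N}"
    have link: "(x, y) \<in> ?r\<^sup>*" if ef: "e \<in> D z u" "f \<in> D z u" "e \<inter> f \<noteq> {}"
      and xy: "x \<in> nodes {e}" "y \<in> nodes {f}" for x y e f
    proof -
      have E: "e \<in> edges G" "f \<in> edges G" using ef by (auto simp: D_def)
      have mono: "{(x, y). {x, y} \<in> edges T \<and> x \<in> nodes {g} \<and> y \<in> nodes {g}} \<subseteq> ?r"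
        if "g \<in> D z u" for g using that by (auto simp: nodes_def)
      obtain w where w: "w \<in> nodes {e}" "w \<in> nodes {f}" using meet[OF E ef(3)] by blast
      have "(x, w) \<in> ?r\<^sup>*" "(w, y) \<in> ?r\<^sup>*"
        using edge_con(1)[OF E(1)] edge_con(1)[OF E(2)] xy w rtrancl_mono[OF mono[OF ef(1)]]
          rtrancl_mono[OF mono[OF ef(2)]] unfolding connected_in_def by blast+
      then show ?thesis by (rule rtrancl_trans)
    qed
    \<comment> \<open>A walk in the component is lifted to the tree: successive edges of the walk
      share a vertex, so their subtrees meet and can be linked. The last edge \<open>f\<close> may
      be any surviving edge of the component at the end of the walk, which the induction
      needs.\<close>
    have reach: "(x, y) \<in> ?r\<^sup>*"
      if "(a, b) \<in> {(a, b). {a, b} \<in> edges G - A z}\<^sup>*" "a \<in> component G (A z) u"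
        "e \<in> D z u" "a \<in> e" "f \<in> D z u" "b \<in> f" "x \<in> nodes {e}" "y \<in> nodes {f}" for a b e f x y
      using that
    proof (induction arbitrary: f y rule: rtrancl_induct)
      case base
      then show ?case using link[of e f x y] by blast
    next
      case (step b b')
      have "b \<in> component G (A z) u" "b' \<in> component G (A z) u"
        using step.hyps step.prems(1) unfolding component_def
        by (auto intro: rtrancl_trans rtrancl_into_rtrancl)
      then have g: "{b, b'} \<in> D z u" using step.hyps by (auto simp: D_def)
      then obtain w where w: "w \<in> nodes {{b, b'}}" using edge_con(2) by (fastforce simp: D_def)
      have "(x, w) \<in> ?r\<^sup>*"
        using step.IH[OF step.prems(1-3) g _ step.prems(6) w] by blast
      moreover have "(w, y) \<in> ?r\<^sup>*" using link[OF g step.prems(4) _ w step.prems(7)] step.prems(5) by blast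
      ultimately show ?case by (rule rtrancl_trans)
    qed
    show ?thesis unfolding connected_in_def
    proof (intro ballI)
      fix x y assume "x \<in> ?N" "y \<in> ?N"
      then obtain e f where ef: "e \<in> D z u" "f \<in> D z u" "x \<in> nodes {e}" "y \<in> nodes {f}"
        by (auto simp: nodes_def)
      then have "e \<noteq> {}" "f \<noteq> {}" using G by (auto simp: D_def simple_graph_def)
      then obtain a b where ab: "a \<in> e" "b \<in> f" by blast
      then have c: "a \<in> component G (A z) u" "b \<in> component G (A z) u" using ef by (auto simp: D_def)
      then have "b \<in> component G (A z) a" using component_eq by fast
      then have "(a, b) \<in> {(a, b). {a, b} \<in> edges G - A z}\<^sup>*" by (simp add: component_def)
      from reach[OF this c(1) ef(1) ab(1) ef(2) ab(2) ef(3,4)] show "(x, y) \<in> ?r\<^sup>*" .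
    qed
  qed

  have "\<exists>z\<in>verts T. \<forall>u. \<not> big z u"
  proof (rule ccontr)
    assume "\<not> ?thesis"
    then obtain U where U: "\<And>z. z \<in> verts T \<Longrightarrow> big z (U z)" by metis
    let ?\<S> = "(\<lambda>z. nodes (D z (U z))) ` verts T"
    have "\<Inter>?\<S> \<noteq> {}"
    proof (rule Helly_forest[OF T(1,2)])
      show "?\<S> \<noteq> {}" using T(3) by simp
      show "S \<subseteq> verts T \<and> connected_in T S" if "S \<in> ?\<S>" for S
        using that U D_con by (auto simp: nodes_def)
      show "S \<inter> S' \<noteq> {}" if SS: "S \<in> ?\<S>" "S' \<in> ?\<S>" for S S'
      proof -
        obtain y z where yz: "y \<in> verts T" "z \<in> verts T" "S = nodes (D y (U y))" "S' = nodes (D z (U z))"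
          using SS by blast
        let ?Y = "component G (A y) (U y)" and ?Z = "component G (A z) (U z)"
        have b: "big y (U y)" "big z (U z)" using yz U by auto
        have fin: "finite (verts G)" using G by (simp add: simple_graph_def)
        have sub: "?Y \<subseteq> verts G" "?Z \<subseteq> verts G"
          using b component_subset[OF G] by (auto simp: big_def)
        have "?Y \<inter> ?Z \<noteq> {}"
        proof
          assume disj: "?Y \<inter> ?Z = {}"
          have "card ?Y + card ?Z = card (?Y \<union> ?Z)"
            using disj sub fin by (intro card_Un_disjoint[symmetric]) (auto intro: finite_subset)
          also have "\<dots> \<le> ?n" using sub fin by (intro card_mono) auto
          finally show False using b disj by (auto simp: big_def)
        qed
        then obtain w where w: "w \<in> ?Y" "w \<in> ?Z" by blast
        \<comment> \<open>Surviving edges of the two components at their common vertex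
          \<open>w\<close> are incident to each other, so some bag contains both.\<close>
        obtain e f where ef: "e \<in> D y (U y)" "w \<in> e" "f \<in> D z (U z)" "w \<in> f"
          using incident b w by meson
        then have "nodes {e} \<inter> nodes {f} \<noteq> {}" by (intro meet) (auto simp: D_def)
        moreover have "nodes {e} \<subseteq> S" "nodes {f} \<subseteq> S'" using ef yz by (auto simp: nodes_def)
        ultimately show ?thesis by blast
      qed
    qed
    then obtain z where z: "\<And>S. S \<in> ?\<S> \<Longrightarrow> z \<in> S" by blast
    obtain y where "y \<in> verts T" using T(3) by blast
    then have "z \<in> verts T" using z[of "nodes (D y (U y))"] by (auto simp: nodes_def)
    \<comment> \<open>The common node \<open>z\<close> also lies in the node set chosen for
      \<open>z\<close> itself, yet the edges in \<open>D z (U z)\<close> avoid the bag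
      \<open>A z\<close>.\<close>
    then show False using z[of "nodes (D z (U z))"] by (auto simp: nodes_def D_def)
  qed
  then obtain z where z: "z \<in> verts T" "\<And>u. \<not> big z u" by blast
  then show thesis using that[of z] v0 refl by (force simp: big_def not_less)
qed

section \<open>Edges inside the parts of a vertex partition\<close>

text \<open>The Turan number: the maximal number of edges of a \<open>k\<close>-partite graph on \<open>m\<close> vertices.\<close>

definition multipartite_bound :: "nat \<Rightarrow> nat \<Rightarrow> nat" where
  "multipartite_bound k m = (\<Sum>j<m. j - j div k)"

lemma multipartite_bound_Suc:
  "multipartite_bound k (Suc m) = multipartite_bound k m + (m - m div k)"
  by (simp add: multipartite_bound_def)

text \<open>With s = m div k, the balanced class sizes p are s or s + 1, so each satisfies p^2 = (2s
  + 1) p - s (s + 1). The right-hand side is m^2 minus the sum of these squares.\<close>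

lemma multipartite_bound_closed:
  assumes "k \<ge> 1"
  shows "2 * int (multipartite_bound k m) =
    int m ^ 2 - (2 * int (m div k) + 1) * int m + int k * int (m div k) * (int (m div k) + 1)"
proof (induction m)
  case (Suc m)
  define s where "s = m div k"
  have le: "s \<le> m" by (simp add: s_def)
  have step: "2 * int (multipartite_bound k (Suc m)) =
      int m ^ 2 - (2 * int s + 1) * int m + int k * int s * (int s + 1) + 2 * (int m - int s)"
    using Suc of_nat_diff[OF le, where ?'a = int] unfolding s_def multipartite_bound_Suc
    by (simp only: of_nat_add distrib_left)
  show ?case
  \<comment> \<open>The quotient changes only when k divides m + 1; there m = k (s + 1) - 1, and the
    formulas for both quotients agree at m + 1.\<close>
  proof (cases "Suc m mod k = 0")
    case True
    then have s': "Suc m div k = Suc s" by (simp add: div_Suc s_def)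
    then have "Suc m = k * Suc s" using True by (metis mult_div_mod_eq add.right_neutral)
    then have m: "int m = int k * (int s + 1) - 1"
      by (metis of_nat_Suc of_nat_mult add_diff_cancel_left' add.commute)
    show ?thesis unfolding step s' of_nat_Suc m by (simp add: algebra_simps power2_eq_square)
  next
    case False
    then have s': "Suc m div k = s" by (simp add: div_Suc s_def)
    show ?thesis unfolding step s' by (simp add: algebra_simps power2_eq_square)
  qed
qed (simp add: multipartite_bound_def)

text \<open>Ordered pairs count every edge twice but avoid two-element sets, so that the count is a
  square minus a sum of squares. Only the class index, the first coordinate, matters.\<close>

definition cross_pairs :: "(nat \<times> 'b) set \<Rightarrow> ((nat \<times> 'b) \<times> (nat \<times> 'b)) set" where
  "cross_pairs U = {(u, v). u \<in> U \<and> v \<in> U \<and> fst u \<noteq> fst v}"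

lemma card_cross_pairs:
  assumes "finite U" "fst ` U \<subseteq> {..<k}"
  shows "int (card (cross_pairs U)) = int (card U) ^ 2 - (\<Sum>j<k. int (card {u \<in> U. fst u = j}) ^ 2)"
    and "(\<Sum>j<k. card {u \<in> U. fst u = j}) = card U"
proof -
  let ?C = "\<lambda>j. {u \<in> U. fst u = j}"
  have "U = (\<Union>j<k. ?C j)" using assms by auto
  then have "card U = card (\<Union>j<k. ?C j)" by simp
  also have "\<dots> = (\<Sum>j<k. card (?C j))" by (rule card_UN_disjoint) (use assms in auto)
  finally show "(\<Sum>j<k. card (?C j)) = card U" ..
  have "U \<times> U = cross_pairs U \<union> (\<Union>j<k. ?C j \<times> ?C j)" using assms by (auto simp: cross_pairs_def)
  moreover have "card (cross_pairs U \<union> (\<Union>j<k. ?C j \<times> ?C j)) = card (cross_pairs U) + card (\<Union>j<k. ?C j \<times> ?C j)"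
  proof (rule card_Un_disjoint)
    show "finite (cross_pairs U)"
      by (rule finite_subset[of _ "U \<times> U"]) (use assms in \<open>auto simp: cross_pairs_def\<close>)
  qed (use assms in \<open>auto simp: cross_pairs_def\<close>)
  moreover have "card (\<Union>j<k. ?C j \<times> ?C j) = (\<Sum>j<k. card (?C j \<times> ?C j))"
    by (rule card_UN_disjoint) (use assms in auto)
  ultimately have "card (U \<times> U) = card (cross_pairs U) + (\<Sum>j<k. card (?C j \<times> ?C j))" by argo
  from arg_cong[OF this, of int]
  show "int (card (cross_pairs U)) = int (card U) ^ 2 - (\<Sum>j<k. int (card (?C j)) ^ 2)"
    by (simp add: power2_eq_square card_cartesian_product)
qed

text \<open>Turan's bound by integrality: summing (p - s) (p - s - 1) >= 0 over the class sizes p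
  bounds their sum of squares from below by its value for balanced classes.\<close>

lemma card_cross_pairs_le:
  fixes U :: "(nat \<times> 'b) set"
  assumes "finite U" "fst ` U \<subseteq> {..<k}" "k \<ge> 1"
  shows "card (cross_pairs U) \<le> 2 * multipartite_bound k (card U)"
proof -
  define s where "s = int (card U div k)"
  define p where "p j = int (card {u \<in> U. fst u = j})" for j
  \<comment> \<open>No integer lies strictly between \<open>s\<close> and \<open>s + 1\<close>.\<close>
  have int_prod: "0 \<le> (x - s) * (x - s - 1)" for x
    by (cases "x \<le> s") (simp_all add: mult_nonpos_nonpos)
  have "0 \<le> (\<Sum>j<k. (p j - s) * (p j - s - 1))" by (intro sum_nonneg int_prod)
  also have "\<dots> = (\<Sum>j<k. p j ^ 2 - (2 * s + 1) * p j + s * (s + 1))"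
    by (rule sum.cong) (auto simp: algebra_simps power2_eq_square)
  also have "\<dots> = (\<Sum>j<k. p j ^ 2) - (2 * s + 1) * (\<Sum>j<k. p j) + int k * s * (s + 1)"
    by (simp only: sum.distrib sum_subtractf sum_distrib_left[symmetric] sum_constant card_lessThan)
      (simp add: algebra_simps)
  also have "(\<Sum>j<k. p j) = int (card U)"
    unfolding p_def card_cross_pairs(2)[OF assms(1,2), symmetric] of_nat_sum ..
  finally have "int (card (cross_pairs U)) \<le> 2 * int (multipartite_bound k (card U))"
    using card_cross_pairs(1)[OF assms(1,2)] multipartite_bound_closed[OF assms(3), of "card U"]
    unfolding p_def[symmetric] s_def[symmetric] by linarith
  then show ?thesis by linarith
qed

section \<open>Convexity and extremal part sizes\<close>

lemma convex_shift:
  fixes h :: "nat \<Rightarrow> nat"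
  assumes "\<And>i j. i \<le> j \<Longrightarrow> h (Suc i) + h j \<le> h i + h (Suc j)" "a \<le> b"
  shows "h (a + d) + h b \<le> h a + h (b + d)"
proof (induction d)
  case (Suc d)
  then show ?case using assms(1)[of "a + d" "b + d"] \<open>a \<le> b\<close> by simp
qed simp

text \<open>Convexity, stated additively to avoid subtraction of naturals, favours unequal parts: it
  is best to fill one part up to the cap \<open>L\<close> and to put the rest into a second. The
  induction adds one part at a time to these two piles.\<close>

lemma sum_convex_le:
  fixes h :: "nat \<Rightarrow> nat"
  assumes conv: "\<And>i j. i \<le> j \<Longrightarrow> h (Suc i) + h j \<le> h i + h (Suc j)" and "h 0 = 0"
    and "finite Q" "\<And>q. q \<in> Q \<Longrightarrow> x q \<le> L" "sum x Q \<le> 2 * L"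
  shows "(\<Sum>q\<in>Q. h (x q)) \<le> h (min (sum x Q) L) + h (sum x Q - L)"
  using assms(3-5)
proof (induction Q rule: finite_induct)
  case (insert q Q)
  define N where "N = sum x Q"
  have IH: "(\<Sum>q\<in>Q. h (x q)) \<le> h (min N L) + h (N - L)"
    using insert by (simp add: N_def)
  have xL: "x q \<le> L" using insert by simp
  have *: "h (min N L) + h (N - L) + h (x q) \<le> h (min (N + x q) L) + h (N + x q - L)"
  \<comment> \<open>Three cases: the new part fits into the first pile, it fills that pile and
    overflows, or the pile is already full.\<close>
  proof (cases "N + x q \<le> L")
    case True
    then show ?thesis using convex_shift[where h = h, OF conv, of 0 "x q" N] \<open>h 0 = 0\<close> by (simp add: add.commute)
  next
    case False
    show ?thesis
    proof (cases "N \<le> L")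
      case True
      then have le: "N + x q - L \<le> x q" and
        eqs: "N + x q - L + (L - x q) = N" "x q + (L - x q) = L" "N - L = 0" "min N L = N"
          "min (N + x q) L = L"
        using False xL by auto
      \<comment> \<open>Moving \<open>L - x q\<close> units from the pair \<open>(N, x q)\<close>
        turns it into the more unequal pair \<open>(N + x q - L, L)\<close>.\<close>
      show ?thesis
        using convex_shift[where h = h and d = "L - x q", OF conv le] unfolding eqs \<open>h 0 = 0\<close>
        by simp
    next
      case False
      then show ?thesis using convex_shift[where h = h, OF conv, of 0 "x q" "N - L"] \<open>h 0 = 0\<close>
        by (simp add: add.commute)
    qed
  qed
  have "sum x (insert q Q) = N + x q" using insert by (simp add: N_def)
  moreover have "(\<Sum>q\<in>insert q Q. h (x q)) = h (x q) + (\<Sum>q\<in>Q. h (x q))"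
    using insert by simp
  ultimately show ?case using IH * by simp
qed (use \<open>h 0 = 0\<close> in simp)

lemma multipartite_bound_mono: "m \<le> m' \<Longrightarrow> multipartite_bound k m \<le> multipartite_bound k m'"
  unfolding multipartite_bound_def by (rule sum_mono2) auto

text \<open>Reserving one vertex for each of the at least three parts leaves at most n - 3 vertices
  to distribute under the cap M - 1. The extremal distribution has parts M, n - 1 - M and 1, the
  last of which holds no edges.\<close>

lemma multipartite_bound_partition_le:
  assumes "finite Q" "card Q \<ge> 3" "\<And>q. q \<in> Q \<Longrightarrow> 1 \<le> m q \<and> m q \<le> M" "sum m Q = n"
    and "2 * M \<le> n" "n \<le> 2 * M + 1"
  shows "(\<Sum>q\<in>Q. multipartite_bound k (m q)) \<le> multipartite_bound k M + multipartite_bound k (n - 1 - M)"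
proof -
  \<comment> \<open>The shift by one accounts for the reserved vertex, and makes
    \<open>h 0 = 0\<close> because a single vertex has no edges.\<close>
  define h where "h x = multipartite_bound k (Suc x)" for x
  have h0: "h 0 = 0" by (simp add: h_def multipartite_bound_def)
  have mono: "j - j div k \<le> Suc j - Suc j div k" for j
    by (auto simp: div_Suc intro: diff_le_mono)
  have conv: "h (Suc i) + h j \<le> h i + h (Suc j)" if "i \<le> j" for i j
  proof -
    \<comment> \<open>These are the increments of \<open>h\<close>; convexity amounts to their being
      nondecreasing.\<close>
    have "Suc i - Suc i div k \<le> Suc j - Suc j div k"
      using lift_Suc_mono_le[of "\<lambda>j. j - j div k", OF mono] that by simp
    then show ?thesis unfolding h_def multipartite_bound_Suc[of k "Suc _"] by linarith
  qed
  obtain q where "q \<in> Q" using assms(2) by fastforce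
  then have M: "M \<ge> 1" using assms(3) by fastforce
  define N where "N = (\<Sum>q\<in>Q. m q - 1)"
  have Sm: "Suc (m q - 1) = m q" if "q \<in> Q" for q using assms(3)[OF that] by simp
  then have "n = (\<Sum>q\<in>Q. (m q - 1) + 1)" unfolding assms(4)[symmetric] by simp
  then have n: "n = N + card Q" unfolding sum.distrib N_def by simp
  have "(\<Sum>q\<in>Q. multipartite_bound k (m q)) = (\<Sum>q\<in>Q. h (m q - 1))"
    unfolding h_def by (rule sum.cong) (simp_all only: Sm)
  also have "\<dots> \<le> h (min N (M - 1)) + h (N - (M - 1))"
    unfolding N_def
  proof (rule sum_convex_le[OF conv h0 assms(1)])
    show "(\<Sum>q\<in>Q. m q - 1) \<le> 2 * (M - 1)" using n assms(2,6) M by (simp add: N_def)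
  qed (use assms(3) in \<open>auto intro: diff_le_mono\<close>)
  also have "h (min N (M - 1)) \<le> multipartite_bound k M"
    unfolding h_def using M by (intro multipartite_bound_mono) auto
  also have "h (N - (M - 1)) \<le> multipartite_bound k (n - 1 - M)"
  proof (cases "N \<le> M - 1")
    case False
    then show ?thesis unfolding h_def using n assms(2) M by (intro multipartite_bound_mono) auto
  qed (simp add: h0)
  finally show ?thesis by simp
qed

section \<open>Lower bound\<close>

lemma card_verts_complete_multipartite:
  "card (verts (complete_multipartite (replicate k c))) = k * c"
proof -
  have "verts (complete_multipartite (replicate k c)) = {..<k} \<times> {..<c}"
    by (auto simp: complete_multipartite_def Let_def)
  then show ?thesis by (simp add: card_cartesian_product)
qed

lemma edge_complete_multipartite_iff:
  "{u, v} \<in> edges (complete_multipartite ns) \<longleftrightarrow>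
    u \<in> verts (complete_multipartite ns) \<and> v \<in> verts (complete_multipartite ns) \<and> fst u \<noteq> fst v"
proof -
  let ?V = "verts (complete_multipartite ns)"
  have eq: "edges (complete_multipartite ns) = {{u, v} | u v. u \<in> ?V \<and> v \<in> ?V \<and> fst u \<noteq> fst v}"
    by (simp add: complete_multipartite_def Let_def)
  show ?thesis
  proof
    assume "{u, v} \<in> edges (complete_multipartite ns)"
    then obtain a b where ab: "a \<in> ?V" "b \<in> ?V" "fst a \<noteq> fst b" "{u, v} = {a, b}"
      unfolding eq by blast
    from ab(4) have "u = a \<and> v = b \<or> u = b \<and> v = a" by (simp only: doubleton_eq_iff)
    with ab(1-3) show "u \<in> ?V \<and> v \<in> ?V \<and> fst u \<noteq> fst v" by metis
  next
    assume "u \<in> ?V \<and> v \<in> ?V \<and> fst u \<noteq> fst v"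
    then show "{u, v} \<in> edges (complete_multipartite ns)" unfolding eq by blast
  qed
qed

lemma card_ordered_pairs:
  assumes "finite X" "\<And>e. e \<in> X \<Longrightarrow> card e = 2"
  shows "card {(u, v). {u, v} \<in> X} = 2 * card X"
proof -
  have two: "card {(u, v). {u, v} = e} = 2 \<and> finite {(u, v). {u, v} = e}" if e: "e \<in> X" for e
  proof -
    obtain a b where "e = {a, b}" "a \<noteq> b" using assms(2)[OF e] by (auto simp: card_2_iff)
    moreover have "{(u, v). {u, v} = {a, b}} = {(a, b), (b, a)}" by (auto simp: doubleton_eq_iff)
    ultimately show ?thesis by simp
  qed
  have "card {(u, v). {u, v} \<in> X} = card (\<Union>e\<in>X. {(u, v). {u, v} = e})"
    by (rule arg_cong[of _ _ card]) auto
  also have "\<dots> = (\<Sum>e\<in>X. card {(u, v). {u, v} = e})"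
    by (rule card_UN_disjoint) (use assms(1) two in auto)
  also have "\<dots> = 2 * card X" using two by simp
  finally show ?thesis .
qed

text \<open>For a balanced bag, every edge outside it lies inside a component of the remaining
  graph. The left-hand side is twice the number of edges of G, and the two bounds limit what the
  components can keep.\<close>

lemma tree_decomposition_large_bag:
  fixes k c :: nat
  defines "n \<equiv> k * c"
  defines "M \<equiv> n div 2"
  assumes td: "tree_decomposition (line_graph (complete_multipartite (replicate k c))) T A"
    and n: "n \<ge> 3"
  obtains z where "z \<in> verts T" "int k * int c ^ 2 * (int k - 1) \<le>
    2 * int (card (A z)) + 2 * int (multipartite_bound k M) + 2 * int (multipartite_bound k (n - 1 - M))"
proof -
  let ?G = "complete_multipartite (replicate k c)"
  let ?V = "verts ?G"
  have k: "k \<ge> 1" and c: "c \<ge> 1" using n by (cases k; cases c; simp add: n_def)+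
  have G: "simple_graph ?G" by (rule simple_graph_complete_multipartite)
  have fin: "finite ?V" by (rule finite_complete_multipartite)
  have V: "?V = {..<k} \<times> {..<c}" by (auto simp: complete_multipartite_def Let_def)
  have cV: "card ?V = n" by (simp add: n_def card_verts_complete_multipartite)
  have v0: "(0, 0) \<in> ?V" using k c by (simp add: V)
  obtain z where z: "z \<in> verts T"
    and half: "\<And>u. u \<in> ?V \<Longrightarrow> 2 * card (component ?G (A z) u) \<le> n"
    and strict: "2 * card (component ?G (A z) (0, 0)) \<noteq> n"
    using tree_decomposition_line_graph_balanced[OF G v0 _ td] n unfolding cV by metis
  define X where "X = A z"
  have X: "X \<subseteq> edges ?G" using td z by (auto simp: X_def tree_decomposition_def line_graph_def)
  have finE: "finite (edges ?G)"
    using simple_graph_line_graph[OF G] by (simp add: simple_graph_def line_graph_def)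
  define Q where "Q = component ?G X ` ?V"
  have sub: "U \<subseteq> ?V" if "U \<in> Q" for U using that component_subset[OF G] by (auto simp: Q_def)
  have finU: "finite U" if "U \<in> Q" for U using sub[OF that] fin by (rule finite_subset)
  have refl: "u \<in> component ?G X u" for u by (simp add: component_def)
  have disj: "U \<inter> U' = {}" if "U \<in> Q" "U' \<in> Q" "U \<noteq> U'" for U U'
    using that component_eq[of _ ?G X] unfolding Q_def by (metis (no_types, lifting) disjoint_iff imageE)
  have un: "\<Union>Q = ?V" using sub refl by (fastforce simp: Q_def)
  have finQ: "finite Q" using fin by (simp add: Q_def)
  have sum: "(\<Sum>U\<in>Q. card U) = n"
    using card_Union_disjoint[of Q] disj finU unfolding un cV by (simp add: pairwise_def disjnt_def)
  have bounds: "1 \<le> card U \<and> card U \<le> M" if "U \<in> Q" for U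
  proof -
    obtain u where u: "u \<in> ?V" "U = component ?G X u" using \<open>U \<in> Q\<close> by (auto simp: Q_def)
    then have "card U \<noteq> 0" using refl[of u] finU[OF that] by auto
    then show ?thesis using half[OF u(1)] u(2) by (simp add: X_def M_def)
  qed
  \<comment> \<open>The component of \<open>(0, 0)\<close> has fewer than n/2 vertices, and one
    further component at most n/2, so two components cannot cover all vertices.\<close>
  have "card Q \<ge> 3"
  proof (rule ccontr)
    assume "\<not> ?thesis"
    define U0 where "U0 = component ?G X (0, 0)"
    have U0: "U0 \<in> Q" using v0 by (simp add: U0_def Q_def)
    have small: "2 * card U0 < n" using half[OF v0] strict by (simp add: U0_def X_def)
    have "card (Q - {U0}) \<le> 1" using \<open>\<not> 3 \<le> card Q\<close> U0 finQ by simp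
    moreover have "(\<Sum>U\<in>Q - {U0}. card U) \<le> card (Q - {U0}) * M"
      using bounds by (intro sum_bounded_above[where K = M, simplified]) auto
    ultimately have "(\<Sum>U\<in>Q - {U0}. card U) \<le> M"
      by (metis le_trans mult_le_mono1 mult_1)
    then have "n \<le> card U0 + M" using sum sum.remove[OF finQ U0, of card] by simp
    then show False using small by (simp add: M_def)
  qed
  then have main: "(\<Sum>U\<in>Q. multipartite_bound k (card U)) \<le> multipartite_bound k M + multipartite_bound k (n - 1 - M)"
    by (intro multipartite_bound_partition_le[OF finQ _ bounds sum]) (auto simp: M_def)

  \<comment> \<open>An adjacent pair not in \<open>X\<close> is joined by a surviving edge, hence
    lies within one component.\<close>
  have "cross_pairs ?V \<subseteq> {(u, v). {u, v} \<in> X} \<union> (\<Union>U\<in>Q. cross_pairs U)"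
  proof (clarify)
    fix a b a' b'
    assume ab: "((a, b), (a', b')) \<in> cross_pairs ?V" "((a, b), (a', b')) \<notin> (\<Union>U\<in>Q. cross_pairs U)"
    show "{(a, b), (a', b')} \<in> X"
    proof (rule ccontr)
      assume "{(a, b), (a', b')} \<notin> X"
      then have "(a', b') \<in> component ?G X (a, b)"
        using ab(1) by (auto simp: component_def cross_pairs_def edge_complete_multipartite_iff)
      then have "((a, b), (a', b')) \<in> cross_pairs (component ?G X (a, b))"
        using ab(1) refl by (auto simp: cross_pairs_def)
      moreover have "component ?G X (a, b) \<in> Q" using ab(1) by (auto simp: Q_def cross_pairs_def)
      ultimately show False using ab(2) by blast
    qed
  qed
  moreover have "finite {(u, v). {u, v} \<in> X}"
    by (rule finite_subset[of _ "?V \<times> ?V"]) (use X fin in \<open>auto simp: edge_complete_multipartite_iff\<close>)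
  moreover have "finite (cross_pairs U)" if "U \<in> Q" for U
    by (rule finite_subset[of _ "U \<times> U"]) (use finU[OF that] in \<open>auto simp: cross_pairs_def\<close>)
  ultimately have "card (cross_pairs ?V) \<le> card ({(u, v). {u, v} \<in> X} \<union> (\<Union>U\<in>Q. cross_pairs U))"
    using finQ by (intro card_mono) auto
  also have "\<dots> \<le> card {(u, v). {u, v} \<in> X} + card (\<Union>U\<in>Q. cross_pairs U)" by (rule card_Un_le)
  also have "card {(u, v). {u, v} \<in> X} = 2 * card X"
  proof (rule card_ordered_pairs)
    show "finite X" using X finE by (rule finite_subset)
    show "card e = 2" if "e \<in> X" for e using that X G by (auto simp: simple_graph_def)
  qed
  also have "card (\<Union>U\<in>Q. cross_pairs U) \<le> (\<Sum>U\<in>Q. card (cross_pairs U))"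
    by (rule card_UN_le[OF finQ])
  also have "\<dots> \<le> (\<Sum>U\<in>Q. 2 * multipartite_bound k (card U))"
  proof (rule sum_mono)
    fix U assume "U \<in> Q"
    moreover from this have "U \<subseteq> {..<k} \<times> {..<c}" using sub V by simp
    ultimately show "card (cross_pairs U) \<le> 2 * multipartite_bound k (card U)"
      using finU k by (intro card_cross_pairs_le) auto
  qed
  also have "\<dots> \<le> 2 * (multipartite_bound k M + multipartite_bound k (n - 1 - M))"
    using main by (simp add: sum_distrib_left[symmetric])
  finally have "card (cross_pairs ?V) \<le> 2 * card X + 2 * (multipartite_bound k M + multipartite_bound k (n - 1 - M))"
    by simp
  moreover have "int (card (cross_pairs ?V)) = int k * int c ^ 2 * (int k - 1)"
  proof -
    have "card {u \<in> ?V. fst u = j} = c" if "j < k" for j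
    proof -
      have "{u \<in> ?V. fst u = j} = {j} \<times> {..<c}" using that by (auto simp: V)
      then show ?thesis by (simp add: card_cartesian_product)
    qed
    moreover have "fst ` ?V \<subseteq> {..<k}" by (auto simp: V)
    ultimately show ?thesis using card_cross_pairs(1)[OF fin, of k]
      by (simp add: card_verts_complete_multipartite algebra_simps power2_eq_square)
  qed
  ultimately show thesis using z by (intro that[of z]) (auto simp: X_def)
qed

text \<open>Substitution into the closed form once the quotients by k are known. For even c the two
  orders have quotients c/2 and c/2 - 1; for odd c both have quotient (c - 1)/2. The factor 4 clears
  denominators.\<close>

lemma two_multipartite_bound_halves:
  fixes k c :: nat
  assumes k: "k \<ge> 1" and c: "c \<ge> 1"
  defines "n \<equiv> k * c"
  defines "M \<equiv> n div 2"
  shows "4 * int (multipartite_bound k M + multipartite_bound k (n - 1 - M)) =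
    int k * int c ^ 2 * (int k - 1) - 2 * int c * (int k - 1) -
     (if even c then 0 else if odd k then int k - 1 else int k - 2)"
proof (cases "even c")
  case True
  \<comment> \<open>Writing c/2 as a successor makes the smaller quotient just
    \<open>s\<close>.\<close>
  then obtain s where s: "c = 2 * Suc s" using c by (metis dvdE mult_0_right not0_implies_Suc not_one_le_zero)
  have M: "M = k * Suc s" by (simp add: M_def n_def s)
  have Md: "M div k = Suc s" using k by (simp add: M)
  have "n - 1 - M = k * s + (k - 1)" using k by (simp add: M n_def s algebra_simps)
  moreover have "(k * s + r) div k = s" if "r < k" for r using that by simp
  then have "(k * s + (k - 1)) div k = s" using k by (metis diff_less less_one less_le_trans)
  ultimately have N: "n - 1 - M = k * s + (k - 1)" "(n - 1 - M) div k = s" by simp_all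
  have K: "int (k - 1) = int k - 1" using k by simp
  show ?thesis
    using multipartite_bound_closed[OF k, of M] multipartite_bound_closed[OF k, of "n - 1 - M"] True
    unfolding Md N(2) unfolding N(1) unfolding M unfolding s of_nat_add of_nat_mult of_nat_Suc K
    by (simp add: algebra_simps power2_eq_square)
next
  case False
  then obtain s where s: "c = 2 * s + 1" by (elim oddE)
  have "M = k * s + k div 2" unfolding M_def n_def s using k by (simp add: algebra_simps)
  moreover have "(k * s + k div 2) div k = s" using k by simp
  ultimately have M: "M = k * s + k div 2" "M div k = s" by simp_all
  have "n - 1 - M = k * s + (k - 1 - k div 2)" unfolding M n_def s using k by (simp add: algebra_simps)
  moreover have "(k * s + r) div k = s" if "r < k" for r using that by simp
  then have "(k * s + (k - 1 - k div 2)) div k = s" using k by (meson diff_le_self diff_less le_less_trans less_le_trans zero_less_one)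
  ultimately have N: "n - 1 - M = k * s + (k - 1 - k div 2)" "(n - 1 - M) div k = s" by simp_all
  have K: "int (k - 1 - k div 2) = int k - 1 - int (k div 2)" using k by simp
  show ?thesis
  proof (cases "even k")
    case True
    then obtain t where t: "k = 2 * t" by blast
    have d: "int (k div 2) = int t" by (simp add: t)
    show ?thesis
      using multipartite_bound_closed[OF k, of M] multipartite_bound_closed[OF k, of "n - 1 - M"] False True
      unfolding M(2) N(2) unfolding N(1) unfolding M(1) unfolding of_nat_add of_nat_mult K d unfolding s t
      by (simp add: algebra_simps power2_eq_square)
  next
    case odd: False
    then obtain t where t: "k = 2 * t + 1" by (elim oddE)
    have d: "int (k div 2) = int t" by (simp add: t)
    show ?thesis
      using multipartite_bound_closed[OF k, of M] multipartite_bound_closed[OF k, of "n - 1 - M"] False odd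
      unfolding M(2) N(2) unfolding N(1) unfolding M(1) unfolding of_nat_add of_nat_mult K d unfolding s t
      by (simp add: algebra_simps power2_eq_square)
  qed
qed

section \<open>Upper bound\<close>

definition path_on :: "nat \<Rightarrow> nat graph" where
  "path_on n = ({..<n}, {{i, Suc i} | i. Suc i < n})"

lemma is_path_graph_path_on: "n \<ge> 1 \<Longrightarrow> is_path_graph (path_on n)"
  unfolding is_path_graph_def path_on_def by (intro exI[of _ "[0..<n]"]) (auto, metis Suc_lessD add_0 nth_upt)

lemma path_on_edgeD: "{a, b} \<in> edges (path_on n) \<Longrightarrow> b = Suc a \<or> a = Suc b"
  by (auto simp: path_on_def doubleton_eq_iff)

text \<open>Consecutive entries differ by 1, and distinctness forbids turning back, so the entries
  move steadily in one direction. The last is then at least 2 away from the first and cannot be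
  adjacent to it.\<close>

lemma not_is_cycle_path_on: "\<not> is_cycle (path_on n) xs"
proof
  assume cyc: "is_cycle (path_on n) xs"
  define f where "f i = int (xs ! i)" for i
  have len: "length xs \<ge> 3" and dist: "distinct xs" using cyc by (auto simp: is_cycle_def)
  have step: "\<bar>f (Suc i) - f i\<bar> = 1" if "Suc i < length xs" for i
    using path_on_edgeD[of "xs ! i" "xs ! Suc i" n] cyc that by (auto simp: is_cycle_def f_def)
  have inj: "f i \<noteq> f j" if "i < length xs" "j < length xs" "i \<noteq> j" for i j
    using dist that by (simp add: f_def nth_eq_iff_index_eq)
  define d where "d = f 1 - f 0"
  have diff: "f (Suc i) - f i = d" if "Suc i < length xs" for i
    using that
  proof (induction i)
    case (Suc i)
    then have "f (Suc (Suc i)) \<noteq> f i" using inj[of "Suc (Suc i)" i] by simp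
    moreover have "f (Suc i) - f i = d" using Suc by simp
    ultimately show ?case using step[of i] step[of "Suc i"] Suc.prems by (auto simp: abs_if split: if_splits)
  qed (simp add: d_def)
  have lin: "f i = f 0 + int i * d" if "i < length xs" for i
    using that
  proof (induction i)
    case (Suc i)
    then show ?case using diff[of i] by (simp add: algebra_simps)
  qed simp
  have d: "\<bar>d\<bar> = 1" using step[of 0] len by (simp add: d_def)
  have "xs \<noteq> []" using len by auto
  then have "\<bar>f (length xs - 1) - f 0\<bar> = 1"
    using path_on_edgeD[of "last xs" "hd xs" n] cyc
    by (auto simp: is_cycle_def f_def last_conv_nth hd_conv_nth)
  moreover have "\<bar>f (length xs - 1) - f 0\<bar> = int (length xs - 1)"
    using lin[of "length xs - 1"] len d by (simp add: abs_mult)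
  ultimately show False using len by simp
qed

lemma connected_in_path_on:
  assumes S: "S \<subseteq> {..<n}" and interval: "\<And>i j x. i \<in> S \<Longrightarrow> j \<in> S \<Longrightarrow> i \<le> x \<Longrightarrow> x \<le> j \<Longrightarrow> x \<in> S"
  shows "connected_in (path_on n) S"
proof -
  let ?r = "{(x, y). {x, y} \<in> edges (path_on n) \<and> x \<in> S \<and> y \<in> S}"
  have up: "(i, j) \<in> ?r\<^sup>*" if "i \<in> S" "j \<in> S" "i \<le> j" for i j
    using that(3,1,2)
  proof (induction j rule: dec_induct)
    case (step m)
    then have "m \<in> S" using interval[of i "Suc m" m] by simp
    moreover have "(m, Suc m) \<in> ?r" using \<open>m \<in> S\<close> step S by (auto simp: path_on_def)
    ultimately show ?case using step by (meson rtrancl.rtrancl_into_rtrancl)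
  qed simp
  have "sym (?r\<^sup>*)" by (rule sym_rtrancl) (auto simp: sym_def insert_commute)
  then show ?thesis unfolding connected_in_def using up by (meson nat_le_linear symD)
qed

lemma is_tree_path_on:
  assumes "n \<ge> 1" shows "is_tree (path_on n)"
proof -
  have "connected_in (path_on n) {..<n}" by (rule connected_in_path_on) auto
  then have "connected_graph (induced_subgraph (path_on n) {..<n})"
    using assms by (subst connected_graph_induced_subgraph_iff) (auto simp: path_on_def lessThan_empty_iff)
  moreover have "induced_subgraph (path_on n) {..<n} = path_on n"
    by (auto simp: induced_subgraph_def path_on_def)
  moreover have "simple_graph (path_on n)" by (auto simp: simple_graph_def path_on_def)
  ultimately show ?thesis by (simp add: is_tree_def not_is_cycle_path_on)
qed

section \<open>Path decompositions from vertex orders\<close>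

definition layout_bag :: "'a graph \<Rightarrow> ('a \<Rightarrow> nat) \<Rightarrow> nat \<Rightarrow> 'a set set" where
  "layout_bag G pos i = {e \<in> edges G. \<exists>u\<in>e. \<exists>v\<in>e. pos u \<le> i \<and> i \<le> pos v}"

text \<open>An edge occupies exactly the interval of positions between its endpoints, both included.
  Two edges sharing a vertex \<open>v\<close> therefore meet in the bag at
  \<open>pos v\<close>.\<close>

lemma tree_decomposition_layout:
  assumes G: "simple_graph G" and "n \<ge> 1" and pos: "\<And>v. v \<in> verts G \<Longrightarrow> pos v < n"
  shows "tree_decomposition (line_graph G) (path_on n) (layout_bag G pos)"
  unfolding tree_decomposition_def
proof (intro conjI ballI allI impI)
  show "is_tree (path_on n)" using assms(2) by (rule is_tree_path_on)
  have verts: "verts (path_on n) = {..<n}" by (simp add: path_on_def)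
  show "layout_bag G pos x \<subseteq> verts (line_graph G)" for x
    by (auto simp: layout_bag_def line_graph_def)
  have endpoint: "pos v < n \<and> e \<in> layout_bag G pos (pos v)" if "e \<in> edges G" "v \<in> e" for e v
    using that G pos by (auto simp: layout_bag_def simple_graph_def)
  show "connected_graph (induced_subgraph (path_on n) {x \<in> verts (path_on n). e \<in> layout_bag G pos x})"
    if "e \<in> verts (line_graph G)" for e
  proof (subst connected_graph_induced_subgraph_iff)
    have e: "e \<in> edges G" using that by (simp add: line_graph_def)
    then have "e \<noteq> {}" using G by (auto simp: simple_graph_def)
    then obtain v where "v \<in> e" by blast
    then have "pos v \<in> {x \<in> verts (path_on n). e \<in> layout_bag G pos x}"
      using endpoint[OF e] by (simp add: verts)
    moreover have "connected_in (path_on n) {x \<in> verts (path_on n). e \<in> layout_bag G pos x}"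
    proof (rule connected_in_path_on)
      fix i j x
      assume "i \<in> {x \<in> verts (path_on n). e \<in> layout_bag G pos x}"
        "j \<in> {x \<in> verts (path_on n). e \<in> layout_bag G pos x}" "i \<le> x" "x \<le> j"
      then show "x \<in> {x \<in> verts (path_on n). e \<in> layout_bag G pos x}"
        unfolding layout_bag_def verts by (auto intro: order_trans)
    qed (auto simp: verts)
    ultimately show "{x \<in> verts (path_on n). e \<in> layout_bag G pos x} \<noteq> {} \<and>
        connected_in (path_on n) {x \<in> verts (path_on n). e \<in> layout_bag G pos x}" by blast
  qed auto
  show "\<exists>x\<in>verts (path_on n). e \<in> layout_bag G pos x \<and> f \<in> layout_bag G pos x"
    if ef: "{e, f} \<in> edges (line_graph G)" for e f
  proof -
    obtain v where "e \<in> edges G" "f \<in> edges G" "v \<in> e" "v \<in> f"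
      using ef by (auto simp: line_graph_def doubleton_eq_iff)
    then show ?thesis using endpoint unfolding verts by (intro bexI[of _ "pos v"]) auto
  qed
qed

text \<open>Position t k + j runs through the classes cyclically, and q, r are the layer and class
  of the current vertex. An edge of the bag joins a vertex at or before it to one at or after it in
  another class; the bound is the number of such choices.\<close>

lemma card_layout_bag_le:
  assumes "q < c" "r < k"
  shows "int (card (layout_bag (complete_multipartite (replicate k c)) (\<lambda>(j, t). t * k + j) (q * k + r)))
    \<le> (int k - 1) * (int k * int q * (int c - int q) + int r * (int c - 2 * int q) + int c - int q) - int r ^ 2"
proof -
  let ?G = "complete_multipartite (replicate k c)"
  define i where "i = q * k + r"
  \<comment> \<open>Layers of class \<open>j\<close> at or before position \<open>i\<close>;
    \<open>S j\<close> below holds those at or after it. The current vertex belongs to both sets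
    when \<open>j = r\<close>.\<close>
  define P where "P j = {..<(if j \<le> r then Suc q else q)}" for j
  define S where "S j = {(if r \<le> j then q else Suc q)..<c}" for j
  define I where "I = {(j, j'). j < k \<and> j' < k \<and> j \<noteq> j'}"
  have before: "t \<in> P j" if "j < k" "t * k + j \<le> i" for j t
  proof (rule ccontr)
    assume "t \<notin> P j"
    then have "t \<ge> Suc q \<or> t = q \<and> r < j" by (auto simp: P_def split: if_splits)
    then show False
    proof
      assume "t \<ge> Suc q"
      then have "Suc q * k \<le> t * k" by (rule mult_le_mono1)
      then show False using that(2) assms(2) by (simp add: i_def)
    qed (use that(2) in \<open>simp add: i_def\<close>)
  qed
  have after: "t \<in> S j" if "j < k" "t < c" "i \<le> t * k + j" for j t
  proof (rule ccontr)
    assume "t \<notin> S j"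
    then have "Suc t \<le> q \<or> t = q \<and> j < r" using that(2) by (auto simp: S_def split: if_splits)
    then show False
    proof
      assume "Suc t \<le> q"
      then have "Suc t * k \<le> q * k" by (rule mult_le_mono1)
      then show False using that by (simp add: i_def)
    qed (use that(3) in \<open>simp add: i_def\<close>)
  qed
  have finI: "finite I" by (rule finite_subset[of _ "{..<k} \<times> {..<k}"]) (auto simp: I_def)
  have "layout_bag ?G (\<lambda>(j, t). t * k + j) i \<subseteq>
      (\<Union>(j, j')\<in>I. (\<lambda>(t, t'). {(j, t), (j', t')}) ` (P j \<times> S j'))"
  proof
    fix e assume e: "e \<in> layout_bag ?G (\<lambda>(j, t). t * k + j) i"
    \<comment> \<open>Each edge is oriented from its earlier to its later endpoint.\<close>
    have "\<exists>j t j' t'. e = {(j, t), (j', t')} \<and> j < k \<and> j' < k \<and> t < c \<and> t' < c \<and> j \<noteq> j' \<and>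
        t * k + j \<le> i \<and> i \<le> t' * k + j'"
    proof -
      obtain j t j' t' where d: "e = {(j, t), (j', t')}" "j < k" "j' < k" "t < c" "t' < c" "j \<noteq> j'"
        using e by (auto simp: layout_bag_def complete_multipartite_def Let_def)
      then have "t * k + j \<le> i \<and> i \<le> t' * k + j' \<or> t' * k + j' \<le> i \<and> i \<le> t * k + j"
        using e by (auto simp: layout_bag_def)
      then show ?thesis
      proof
        assume "t' * k + j' \<le> i \<and> i \<le> t * k + j"
        then show ?thesis using d by (intro exI[of _ j'] exI[of _ t'] exI[of _ j] exI[of _ t]) (simp add: insert_commute)
      qed (use d in blast)
    qed
    then obtain j t j' t' where "e = {(j, t), (j', t')}" "(j, j') \<in> I" "t \<in> P j" "t' \<in> S j'"
      using before after by (auto simp: I_def)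
    then show "e \<in> (\<Union>(j, j')\<in>I. (\<lambda>(t, t'). {(j, t), (j', t')}) ` (P j \<times> S j'))" by blast
  qed
  then have "card (layout_bag ?G (\<lambda>(j, t). t * k + j) i) \<le>
      card (\<Union>(j, j')\<in>I. (\<lambda>(t, t'). {(j, t), (j', t')}) ` (P j \<times> S j'))"
    using finI by (intro card_mono) (auto simp: P_def S_def)
  also have "\<dots> \<le> (\<Sum>x\<in>I. card (case x of (j, j') \<Rightarrow> (\<lambda>(t, t'). {(j, t), (j', t')}) ` (P j \<times> S j')))"
    by (rule card_UN_le[OF finI])
  also have "\<dots> \<le> (\<Sum>(j, j')\<in>I. card (P j) * card (S j'))"
  proof (rule sum_mono)
    fix x assume "x \<in> I"
    obtain j j' where x: "x = (j, j')" by fastforce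
    have "card ((\<lambda>(t, t'). {(j, t), (j', t')}) ` (P j \<times> S j')) \<le> card (P j \<times> S j')"
      by (rule card_image_le) (auto simp: P_def S_def)
    then show "card (case x of (j, j') \<Rightarrow> (\<lambda>(t, t'). {(j, t), (j', t')}) ` (P j \<times> S j')) \<le>
        (case x of (j, j') \<Rightarrow> card (P j) * card (S j'))" by (simp add: x card_cartesian_product)
  qed
  finally have le: "int (card (layout_bag ?G (\<lambda>(j, t). t * k + j) i)) \<le>
      int (\<Sum>(j, j')\<in>I. card (P j) * card (S j'))" by (rule of_nat_mono)
  define p where "p j = int q + (if j \<le> r then 1 else 0)" for j
  define s where "s j = int c - int q - (if j < r then 1 else 0)" for j
  have ps: "int (card (P j)) = p j" "int (card (S j)) = s j" for j
    using assms(1) by (auto simp: P_def S_def p_def s_def)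
  \<comment> \<open>Adding the diagonal turns the sum over distinct classes into a product of two
    sums, from which the diagonal terms are then subtracted.\<close>
  have "I \<union> (\<lambda>j. (j, j)) ` {..<k} = {..<k} \<times> {..<k}" by (auto simp: I_def)
  then have "(\<Sum>(j, j')\<in>{..<k} \<times> {..<k}. p j * s j') =
      (\<Sum>(j, j')\<in>I. p j * s j') + (\<Sum>(j, j')\<in>(\<lambda>j. (j, j)) ` {..<k}. p j * s j')"
    using finI by (subst sum.union_disjoint[symmetric]) (auto simp: I_def)
  also have "(\<Sum>(j, j')\<in>(\<lambda>j. (j, j)) ` {..<k}. p j * s j') = (\<Sum>j<k. p j * s j)"
    by (subst sum.reindex) (auto simp: inj_on_def)
  also have "(\<Sum>(j, j')\<in>{..<k} \<times> {..<k}. p j * s j') = (\<Sum>j<k. p j) * (\<Sum>j<k. s j)"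
    by (simp add: sum_product sum.cartesian_product)
  finally have sum: "int (\<Sum>(j, j')\<in>I. card (P j) * card (S j')) = (\<Sum>j<k. p j) * (\<Sum>j<k. s j) - (\<Sum>j<k. p j * s j)"
    by (simp add: of_nat_sum ps case_prod_unfold)
  have cnt: "(\<Sum>j<k. if j \<le> r then 1 else 0 :: int) = int r + 1" "(\<Sum>j<k. if j < r then 1 else 0 :: int) = int r"
  proof -
    have "{j \<in> {..<k}. j \<le> r} = {..r}" "{j \<in> {..<k}. j < r} = {..<r}" using assms(2) by auto
    then show "(\<Sum>j<k. if j \<le> r then 1 else 0 :: int) = int r + 1" "(\<Sum>j<k. if j < r then 1 else 0 :: int) = int r"
      by (simp_all add: sum.If_cases Int_def)
  qed
  have sp: "(\<Sum>j<k. p j) = int k * int q + int r + 1" unfolding p_def sum.distrib cnt by simp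
  have ss: "(\<Sum>j<k. s j) = int k * (int c - int q) - int r" unfolding s_def sum_subtractf cnt by (simp add: algebra_simps)
  \<comment> \<open>The product of the two indicators is the indicator of \<open>j < r\<close>,
    since \<open>j < r\<close> implies \<open>j \<le> r\<close>.\<close>
  have "p j * s j = int q * (int c - int q) + (int c - int q) * (if j \<le> r then 1 else 0) - (int q + 1) * (if j < r then 1 else 0)" for j
    by (simp add: p_def s_def algebra_simps)
  then have "(\<Sum>j<k. p j * s j) = int k * (int q * (int c - int q)) + (int c - int q) * (int r + 1) - (int q + 1) * int r"
    by (simp only: sum_subtractf sum.distrib sum_distrib_left[symmetric] cnt sum_constant card_lessThan)
      (simp add: algebra_simps)
  then have "int (\<Sum>(j, j')\<in>I. card (P j) * card (S j')) =
      (int k - 1) * (int k * int q * (int c - int q) + int r * (int c - 2 * int q) + int c - int q) - int r ^ 2"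
    unfolding sum sp ss by (simp add: algebra_simps power2_eq_square)
  with le show ?thesis unfolding i_def by linarith
qed

section \<open>Matching the bounds with the closed form\<close>

text \<open>Four times (width plus one), in order to stay within the integers.\<close>

definition width_value :: "nat \<Rightarrow> nat \<Rightarrow> int" where
  "width_value k c = (int k - 1) * (int k * int c ^ 2 + 2 * int c) +
     (if even c then 0 else if odd k then int k - 1 else int k - 2)"

lemma tree_decomposition_bag_ge:
  assumes "k \<ge> 1" "c \<ge> 1"
    and td: "tree_decomposition (line_graph (complete_multipartite (replicate k c))) T A"
  obtains z where "z \<in> verts T" "width_value k c \<le> 4 * int (card (A z))"
proof -
  let ?G = "complete_multipartite (replicate k c)"
  obtain z0 where z0: "z0 \<in> verts T"
    using td by (auto simp: tree_decomposition_def is_tree_def connected_graph_def)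
  \<comment> \<open>The balanced bag needs three vertices. What remains is k = 1, where the required
    value is 0, and the single edge K_{1,1}, where it is 4 and some bag must contain that
    edge.\<close>
  consider "k * c \<ge> 3" | "k = 1" | "k = 2" "c = 1"
  proof -
    have "k * c \<ge> 3" if "k \<ge> 2" "\<not> (k = 2 \<and> c = 1)"
    proof (cases "c = 1")
      case False
      then show ?thesis using mult_le_mono[of 2 k 2 c] that assms by simp
    qed (use that in simp)
    then show ?thesis using that assms by fastforce
  qed
  then show thesis
  proof cases
    case 1
    from tree_decomposition_large_bag[OF td 1] obtain z where z: "z \<in> verts T"
      "int k * int c ^ 2 * (int k - 1) \<le> 2 * int (card (A z)) +
        2 * int (multipartite_bound k (k * c div 2)) + 2 * int (multipartite_bound k (k * c - 1 - k * c div 2))"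
      by blast
    define e where "e = (if even c then 0 else if odd k then int k - 1 else int k - 2)"
    have "width_value k c = int k * int c ^ 2 * (int k - 1) + 2 * int c * (int k - 1) + e"
      by (simp add: width_value_def e_def algebra_simps)
    moreover define m where "m = int (multipartite_bound k (k * c div 2))"
    moreover define m' where "m' = int (multipartite_bound k (k * c - 1 - k * c div 2))"
    ultimately show thesis
      using two_multipartite_bound_halves[OF assms(1,2)] z(2) unfolding e_def[symmetric] of_nat_add
      by (intro that[OF z(1)]) simp
  next
    case 2
    then show thesis using z0 by (intro that[of z0]) (simp_all add: width_value_def)
  next
    case 3
    have "{(0, 0), (1, 0)} \<in> edges ?G"
      unfolding edge_complete_multipartite_iff using 3 by (simp add: complete_multipartite_def)
    then have "connected_graph (induced_subgraph T {x \<in> verts T. {(0, 0), (1, 0)} \<in> A x})"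
      using td by (simp add: tree_decomposition_def line_graph_def)
    then obtain z where z: "z \<in> verts T" "{(0, 0), (1, 0)} \<in> A z"
      by (auto simp: connected_graph_def induced_subgraph_def)
    have "A z \<subseteq> edges ?G" using td z by (auto simp: tree_decomposition_def line_graph_def)
    moreover have "finite (edges ?G)"
      using simple_graph_line_graph[OF simple_graph_complete_multipartite, of "replicate k c"]
      by (simp add: simple_graph_def line_graph_def)
    ultimately have "finite (A z)" by (rule finite_subset)
    then have "card (A z) > 0" using z(2) by (auto simp: card_gt_0_iff)
    then show thesis using z 3 by (intro that[of z]) (simp_all add: width_value_def)
  qed
qed

lemma consecutive_product_nonneg: "0 \<le> x * (x + 1)" for x :: int
  by (cases "x \<ge> 0") (simp_all add: mult_nonpos_nonpos)

text \<open>Measuring the layer q from the middle by \<open>a = int q - int s\<close>, the gap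
  between both sides becomes an explicit expression in \<open>a\<close> and \<open>r\<close>, whose
  sign is settled by the parity of c and the sign of \<open>a\<close>.\<close>

lemma layout_bag_size_le:
  assumes "q < c" "r < k"
  shows "4 * ((int k - 1) * (int k * int q * (int c - int q) + int r * (int c - 2 * int q) + int c - int q) - int r ^ 2)
    \<le> width_value k c"
proof (cases "even c")
  case True
  then obtain s where s: "c = 2 * s" by blast
  define a where "a = int q - int s"
  have q: "int q = int s + a" by (simp add: a_def)
  have "0 \<le> (int k - 1) * (int k * a ^ 2 + 2 * int r * a + a) + int r ^ 2"
  proof (cases "a \<ge> 0")
    case True
    then show ?thesis using assms by (intro add_nonneg_nonneg mult_nonneg_nonneg) auto
  next
    case False
    define b where "b = - a"
    \<comment> \<open>Reflecting the order exchanges r with k - 1 - r; in \<open>b\<close> and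
      \<open>u\<close> the expression splits into nonnegative summands.\<close>
    define u where "u = int k - 1 - int r"
    have b: "b \<ge> 1" "a = - b" and u: "u \<ge> 0" "int r = int k - 1 - u" using False assms by (auto simp: b_def u_def)
    have "int k * 1 \<le> int k * b" using b by (intro mult_left_mono) auto
    then have f: "0 \<le> int k * b - (int k - 1)" by linarith
    have "0 \<le> (int k - 1) * ((int k * b - (int k - 1)) * (b - 1)) + 2 * (int k - 1) * u * (b - 1) + u ^ 2"
      using b u assms by (intro add_nonneg_nonneg mult_nonneg_nonneg f) auto
    also have "\<dots> = (int k - 1) * (int k * a ^ 2 + 2 * int r * a + a) + int r ^ 2"
      unfolding b(2) u(2) by (simp add: algebra_simps power2_eq_square)
    finally show ?thesis .
  qed
  then show ?thesis using True unfolding width_value_def s of_nat_mult q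
    by (simp add: algebra_simps power2_eq_square)
next
  case False
  then obtain s where s: "c = 2 * s + 1" by (elim oddE)
  define a where "a = int q - int s"
  have q: "int q = int s + a" by (simp add: a_def)
  \<comment> \<open>For odd c the loss in \<open>a\<close> separates from the term r (k - 1 - r):
    this bounds the former by its value at the middle layer, a = 0, and the quadratic in r is
    maximised afterwards.\<close>
  have "int k * (a - a ^ 2) - 2 * int r * a - a \<le> 0"
  proof (cases "a \<ge> 0")
    case True
    have "0 \<le> a * (a - 1)" using consecutive_product_nonneg[of "a - 1"] by (simp add: mult.commute)
    then have "0 \<le> int k * (a * (a - 1)) + 2 * int r * a + a" using True by simp
    then show ?thesis by (simp add: algebra_simps power2_eq_square)
  next
    case False
    define b where "b = - a"
    have b: "b \<ge> 1" "a = - b" using False by (auto simp: b_def)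
    have "int k * 1 \<le> int k * b" using b by (intro mult_left_mono) auto
    then have f: "0 \<le> int k * b - int k + 1" by linarith
    have "0 \<le> b * (int k * b - int k + 1) + 2 * b * (int k - 1 - int r)"
      using b assms by (intro add_nonneg_nonneg mult_nonneg_nonneg f) auto
    then show ?thesis unfolding b(2) by (simp add: algebra_simps power2_eq_square)
  qed
  then have "0 \<le> (int k - 1) * (0 - (int k * (a - a ^ 2) - 2 * int r * a - a))"
    using assms by (intro mult_nonneg_nonneg) auto
  \<comment> \<open>The difference is the square of 2r - (k - 1), less 1 for even k, where that
    number is odd and so has square at least 1.\<close>
  moreover have "4 * (int r * (int k - 1 - int r)) \<le> (int k - 1) ^ 2 - (if odd k then 0 else 1)"
  proof (cases "odd k")
    case True
    have "0 \<le> (2 * int r - (int k - 1)) ^ 2" by simp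
    then show ?thesis using True by (simp add: algebra_simps power2_eq_square)
  next
    case False
    then obtain t where t: "k = 2 * t" by blast
    show ?thesis using consecutive_product_nonneg[of "int r - int t"] False
      unfolding t by (simp add: algebra_simps power2_eq_square)
  qed
  ultimately show ?thesis using False unfolding width_value_def s of_nat_mult of_nat_add q
    by (simp add: algebra_simps power2_eq_square split: if_splits)
qed

theorem theorem3:
  fixes k c :: nat
  assumes "k \<ge> 1" and "c \<ge> 1"
  shows "treewidth (line_graph (complete_multipartite (replicate k c)))
           = pathwidth (line_graph (complete_multipartite (replicate k c))) \<and>
         real_of_int (pathwidth (line_graph (complete_multipartite (replicate k c)))) =
           (if odd k \<and> odd c then
              real c ^ 2 * real k ^ 2 / 4 - real c ^ 2 * real k / 4 + real c * real k / 2
                - real c / 2 + real k / 4 - 5 / 4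
            else if even c then
              real c ^ 2 * real k ^ 2 / 4 - real c ^ 2 * real k / 4 + real c * real k / 2
                - real c / 2 - 1
            else
              real c ^ 2 * real k ^ 2 / 4 - real c ^ 2 * real k / 4 + real c * real k / 2
                - real c / 2 + real k / 4 - 3 / 2)"
proof -
  let ?G = "complete_multipartite (replicate k c)"
  let ?L = "line_graph ?G"
  let ?A = "layout_bag ?G (\<lambda>(j, t). t * k + j)"
  have G: "simple_graph ?G" by (rule simple_graph_complete_multipartite)
  then have L: "simple_graph ?L" by (rule simple_graph_line_graph)
  \<comment> \<open>This lower bound ensures that the \<open>LEAST\<close> over the integers is a
    genuine minimum.\<close>
  have width_ge: "w \<ge> - 1" if "\<exists>(T :: nat graph) A. tree_decomposition ?L T A \<and> width T A = w" for w
    using that by (auto simp: width_def)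

  obtain T :: "nat graph" and A where TA: "tree_decomposition ?L T A" "width T A = treewidth ?L"
    using treewidth_attained[OF L] by blast
  obtain z where "z \<in> verts T" "width_value k c \<le> 4 * int (card (A z))"
    using tree_decomposition_bag_ge[OF assms TA(1)] by blast
  moreover have "finite (verts T)"
    using TA(1) by (simp add: tree_decomposition_def is_tree_def simple_graph_def)
  moreover define mx where "mx = Max ((\<lambda>x. card (A x)) ` verts T)"
  ultimately have "width_value k c \<le> 4 * int (card (A z))" "int (card (A z)) \<le> int mx"
    by (auto intro: Max_ge)
  moreover have "treewidth ?L = int mx - 1" using TA(2) by (simp add: width_def mx_def)
  ultimately have lower: "width_value k c \<le> 4 * (treewidth ?L + 1)" by simp

  obtain P :: "nat graph" and B where PB: "tree_decomposition ?L P B" "is_path_graph P" "width P B = pathwidth ?L"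
    using pathwidth_attained[OF L] by blast
  \<comment> \<open>An optimal path decomposition competes in the minimum defining
    treewidth.\<close>
  have le: "treewidth ?L \<le> pathwidth ?L"
    unfolding treewidth_def using PB width_ge
    by (intro int_Least_attained(2)[where P = "\<lambda>w. \<exists>(T :: nat graph) A. tree_decomposition ?L T A \<and> width T A = w"]) blast+

  have n: "k * c \<ge> 1" using assms by simp
  have pos: "(case v of (j, t) \<Rightarrow> t * k + j) < k * c" if v: "v \<in> verts ?G" for v
  proof -
    obtain j t where jt: "v = (j, t)" "j < k" "t < c"
      using v by (auto simp: complete_multipartite_def Let_def)
    then have "Suc t * k \<le> c * k" by (intro mult_le_mono1) simp
    then show ?thesis using jt by (simp add: mult.commute)
  qed
  have dec: "tree_decomposition ?L (path_on (k * c)) ?A" by (rule tree_decomposition_layout[OF G n pos])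
  have "pathwidth ?L \<le> width (path_on (k * c)) ?A"
    unfolding pathwidth_def
    using PB dec is_path_graph_path_on[OF n] width_ge
    by (intro int_Least_attained(2)[where P = "\<lambda>w. \<exists>(T :: nat graph) A. tree_decomposition ?L T A \<and> is_path_graph T \<and> width T A = w"]) blast+
  moreover have "4 * (width (path_on (k * c)) ?A + 1) \<le> width_value k c"
  proof -
    have "Max ((\<lambda>x. card (?A x)) ` verts (path_on (k * c))) \<in> (\<lambda>x. card (?A x)) ` verts (path_on (k * c))"
      using n by (intro Max_in) (auto simp: path_on_def lessThan_empty_iff)
    then obtain i where i: "i < k * c" and w: "width (path_on (k * c)) ?A + 1 = int (card (?A i))"
      by (auto simp: width_def path_on_def)
    define q r where "q = i div k" and "r = i mod k"
    have qr: "q < c" "r < k" and "i = q * k + r"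
      using i assms by (auto simp: q_def r_def less_mult_imp_div_less mult.commute)
    then have *: "width (path_on (k * c)) ?A + 1 = int (card (?A (q * k + r)))" using w by simp
    have "4 * (width (path_on (k * c)) ?A + 1) \<le> 4 * ((int k - 1) *
        (int k * int q * (int c - int q) + int r * (int c - 2 * int q) + int c - int q) - int r ^ 2)"
      unfolding * by (intro mult_left_mono card_layout_bag_le qr) simp
    then show ?thesis using layout_bag_size_le[OF qr] by (rule order_trans)
  qed
  \<comment> \<open>The chain from \<open>width_value k c\<close> through treewidth, pathwidth and
    the width of the cyclic layout back to \<open>width_value k c\<close> forces equality
    throughout.\<close>
  ultimately have eq: "treewidth ?L = pathwidth ?L" "4 * (pathwidth ?L + 1) = width_value k c"
    using lower le by simp_all
  from arg_cong[OF eq(2), of real_of_int]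
  have pw: "real_of_int (pathwidth ?L) = ((real k - 1) * (real k * real c ^ 2 + 2 * real c) +
      (if even c then 0 else if odd k then real k - 1 else real k - 2)) / 4 - 1"
    by (simp add: width_value_def field_simps split: if_splits)
  show ?thesis unfolding pw using eq(1) by (auto simp: field_simps power2_eq_square)
qed

end
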